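(* Let $G=(V,E)$ be a finite simple graph. The functions $\mathrm{mc}(G,\cdot)$ and $\mathrm{fcc}(G,\cdot)$ satisfy $$\mathrm{mc}(G,w)=\max\{w^Tz : z\in\mathbb{R}_+^E,\ \mathrm{fcc}(G,z)\le1\}\quad\text{for every }w\in\mathbb{R}_+^E,$$ $$\mathrm{fcc}(G,z)=\max\{z^Tw : w\in\mathbb{R}_+^E,\ \mathrm{mc}(G,w)\le1\}\quad\text{for every }z\in\mathbb{R}_+^E,$$ $$w^Tz\le\mathrm{mc}(G,w)\,\mathrm{fcc}(G,z)\quad\text{for every }w,z\in\mathbb{R}_+^E.$$ The functions $\mathrm{GW}(G,\cdot)$ and $\mathrm{GW}^\circ(G,\cdot)$ satisfy $$\mathrm{GW}(G,w)=\max\{w^Tz : z\in\mathbb{R}_+^E,\ \mathrm{GW}^\circ(G,z)\le1\}\quad\text{for every }w\in\mathbb{R}_+^E,$$ $$\mathrm{GW}^\circ(G,z)=\max\{z^Tw : w\in\mathbb{R}_+^E,\ \mathrm{GW}(G,w)\le1\}\quad\text{for every }z\in\mathbb{R}_+^E,$$ $$w^Tz\le\mathrm{GW}(G,w)\,\mathrm{GW}^\circ(G,z)\quad\text{for every }w,z\in\mathbb{R}_+^E.$$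
   Context: For $S\subseteq V$, $\delta(S)\subseteq E$ is the set of edges with exactly one endpoint in $S$, $\chi^{\delta(S)}\in\{0,1\}^E$ its incidence vector, $\mathbf 1$ the all-ones vector, $\mathcal P(V)$ the power set. $\mathrm{mc}(G,w):=\max\{w^T\chi^{\delta(S)}:S\subseteq V\}$. $\mathrm{fcc}(G,z):=\min\{\mathbf 1^{T}y : y\in\mathbb{R}_+^{\mathcal P(V)},\ \sum_{S\subseteq V}y_S\chi^{\delta(S)}\ge z\}$. $\mathbb{S}^V_+$ is the cone of positive semidefinite symmetric $V\times V$ matrices, $\langle A,B\rangle=\mathrm{tr}(A^TB)$, $\mathcal L_G(w):=\sum_{ij\in E}w_{ij}(e_i-e_j)(e_i-e_j)^T$, with adjoint $(\mathcal L_G^*(Y))_{ij}=Y_{ii}+Y_{jj}-Y_{ij}-Y_{ji}$ for $ij\in E$. $\mathrm{GW}(G,w):=\max\{\langle\tfrac14\mathcal L_G(w),Y\rangle : Y\in\mathbb{S}^V_+,\ \mathrm{diag}(Y)=\mathbf 1\}$, and $\mathrm{GW}^\circ(G,z):=\min\{\mu:\mu\in\mathbb{R}_+,\ Y\in\mathbb{S}^V_+,\ \mathrm{diag}(Y)=\mu\mathbf 1,\ \tfrac14\mathcal L_G^*(Y)\ge z\}$. *)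

theory Defs
  imports "HOL-Analysis.Analysis"
begin

text \<open>
  A finite simple graph has the finite type \<open>'v\<close> as its vertex set and a set \<open>E\<close> of
  two-element sets as its edge set.  The cone of nonnegative vectors indexed by \<open>E\<close> is
  \<open>E \<rightarrow>\<^sub>E {0..}\<close>.
\<close>

definition simple_graph :: "'v::finite set set \<Rightarrow> bool" where
  "simple_graph E \<longleftrightarrow> (\<forall>e\<in>E. card e = 2)"

definition edge_inner :: "'v::finite set set \<Rightarrow> ('v set \<Rightarrow> real) \<Rightarrow> ('v set \<Rightarrow> real) \<Rightarrow> real" where
  "edge_inner E w z = (\<Sum>e\<in>E. w e * z e)"

definition cut :: "'v::finite set set \<Rightarrow> 'v set \<Rightarrow> 'v set set" where
  "cut E S = {e \<in> E. card (e \<inter> S) = 1}"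

definition mc :: "'v::finite set set \<Rightarrow> ('v set \<Rightarrow> real) \<Rightarrow> real" where
  "mc E w = Max {edge_inner E w (indicator (cut E S)) | S. S \<in> Pow UNIV}"

text \<open>
  \<open>LEAST\<close> and \<open>GREATEST\<close> denote an attained minimum and maximum; they are unspecified if
  the extremum is not attained.
\<close>

definition fcc :: "'v::finite set set \<Rightarrow> ('v set \<Rightarrow> real) \<Rightarrow> real" where
  "fcc E z = (LEAST t. \<exists>y :: 'v set \<Rightarrow> real.
     (\<forall>S. 0 \<le> y S) \<and>
     (\<forall>e\<in>E. (\<Sum>S\<in>Pow UNIV. y S * indicator (cut E S) e) \<ge> z e) \<and>
     t = (\<Sum>S\<in>Pow UNIV. y S))"

definition psd :: "real^'v^'v::finite \<Rightarrow> bool" where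
  "psd Y \<longleftrightarrow> transpose Y = Y \<and> (\<forall>x. 0 \<le> x \<bullet> (Y *v x))"

definition mat_inner :: "real^'v^'v::finite \<Rightarrow> real^'v^'v \<Rightarrow> real" where
  "mat_inner A B = trace (transpose A ** B)"

text \<open>
  For \<open>f\<close> symmetric in its arguments, \<open>on_ends f e\<close> is the value of \<open>f\<close> at the two ends of
  \<open>e\<close>, in either order.
\<close>

definition on_ends :: "('v \<Rightarrow> 'v \<Rightarrow> 'b) \<Rightarrow> 'v set \<Rightarrow> 'b" where
  "on_ends f e = (THE r. \<exists>i j. e = {i, j} \<and> r = f i j)"

lemma on_ends_doubleton:
  assumes "\<And>i j. f i j = f j i"
  shows "on_ends f {i, j} = f i j"
  unfolding on_ends_def by (rule the_equality) (auto simp: doubleton_eq_iff assms)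

definition edge_matrix :: "'v::finite \<Rightarrow> 'v \<Rightarrow> real^'v^'v" where
  "edge_matrix i j =
     (columnvector (axis i 1 - axis j 1) :: real^1^'v) ** rowvector (axis i 1 - axis j 1)"

definition laplacian :: "'v::finite set set \<Rightarrow> ('v set \<Rightarrow> real) \<Rightarrow> real^'v^'v" where
  "laplacian E w = (\<Sum>e\<in>E. w e *\<^sub>R
     on_ends edge_matrix e)"

definition laplacian_adj :: "real^'v^'v::finite \<Rightarrow> 'v set \<Rightarrow> real" where
  "laplacian_adj Y e = on_ends (\<lambda>i j. Y $ i $ i + Y $ j $ j - Y $ i $ j - Y $ j $ i) e"

lemma on_ends_edge_matrix: "on_ends edge_matrix {i, j} = edge_matrix i j"
  by (rule on_ends_doubleton)
     (auto simp: edge_matrix_def vec_eq_iff columnvector_def rowvector_def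
        matrix_matrix_mult_def algebra_simps)

lemma laplacian_adj_doubleton:
  "laplacian_adj Y {i, j} = Y $ i $ i + Y $ j $ j - Y $ i $ j - Y $ j $ i"
  unfolding laplacian_adj_def by (rule on_ends_doubleton) simp

definition GW :: "'v::finite set set \<Rightarrow> ('v set \<Rightarrow> real) \<Rightarrow> real" where
  "GW E w = (GREATEST t. \<exists>Y :: real^'v^'v.
     psd Y \<and> (\<forall>i. Y $ i $ i = 1) \<and> t = mat_inner ((1/4) *\<^sub>R laplacian E w) Y)"

definition GW_polar :: "'v::finite set set \<Rightarrow> ('v set \<Rightarrow> real) \<Rightarrow> real" where
  "GW_polar E z = (LEAST \<mu>. 0 \<le> \<mu> \<and> (\<exists>Y :: real^'v^'v.
     psd Y \<and> (\<forall>i. Y $ i $ i = \<mu>) \<and> (\<forall>e\<in>E. 1/4 * laplacian_adj Y e \<ge> z e)))"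

definition is_max :: "real set \<Rightarrow> real \<Rightarrow> bool" where
  "is_max A m \<longleftrightarrow> m \<in> A \<and> (\<forall>x\<in>A. x \<le> m)"

end

theory Submission
  imports Defs
begin

text \<open>
  Both halves are one duality between the support function \<open>h(w) = max {\<langle>w, c\<rangle> | c \<in> C}\<close> and the
  covering function \<open>g(z) = min {\<mu> \<ge> 0 | z \<le> \<mu> c for some c \<in> C}\<close> of a compact convex set \<open>C\<close> of
  nonnegative edge vectors that has a strictly positive member.  For \<open>mc\<close> and \<open>fcc\<close>, \<open>C\<close> is the convex
  hull of the cut vectors; for \<open>GW\<close> and \<open>GW\<^sup>\<circ>\<close>, it is the image of the elliptope under a quarter
  of the adjoint Laplacian.  The inequality \<open>\<langle>w, z\<rangle> \<le> h(w) g(z)\<close> is immediate.  A maximiser of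
  \<open>h(w)\<close> attains the first maximum.  For the second with \<open>\<mu> = g(z) > 0\<close>, minimality of \<open>\<mu>\<close> keeps
  \<open>z / \<mu>\<close> out of the convex set of points strictly below a member of \<open>C\<close>; a hyperplane separating the
  two has a nonnegative normal, which after scaling attains the maximum.
\<close>

section \<open>Duality of support and covering functions for a compact convex set\<close>

definition support_value :: "'v::finite set set \<Rightarrow> (real^('v set)) set \<Rightarrow> ('v set \<Rightarrow> real) \<Rightarrow> real" where
  "support_value E C w = (GREATEST t. \<exists>c\<in>C. t = edge_inner E w (($) c))"

definition cover_value :: "'v::finite set set \<Rightarrow> (real^('v set)) set \<Rightarrow> ('v set \<Rightarrow> real) \<Rightarrow> real" where
  "cover_value E C z = (LEAST \<mu>. 0 \<le> \<mu> \<and> (\<exists>c\<in>C. \<forall>e\<in>E. z e \<le> \<mu> * c $ e))"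

lemma edge_inner_commute: "edge_inner E w z = edge_inner E z w"
  by (simp add: edge_inner_def mult.commute)

lemma edge_inner_restrict [simp]:
  "edge_inner E (restrict w E) z = edge_inner E w z" "edge_inner E w (restrict z E) = edge_inner E w z"
  by (simp_all add: edge_inner_def)

lemma edge_inner_mono:
  assumes "\<And>e. e \<in> E \<Longrightarrow> 0 \<le> w e" "\<And>e. e \<in> E \<Longrightarrow> x e \<le> y e"
  shows "edge_inner E w x \<le> edge_inner E w y"
  unfolding edge_inner_def by (intro sum_mono mult_left_mono assms)

lemma edge_inner_scale: "edge_inner E w (\<lambda>e. r * z e) = r * edge_inner E w z"
  by (simp add: edge_inner_def sum_distrib_left algebra_simps)

text \<open>The ambient space has a coordinate for every vertex subset, so that it is a Euclidean
  space as a type; sign conditions are imposed on the coordinates in \<open>E\<close> only. A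
  positive member lets every \<open>z\<close> be covered by a suitable multiple, so the minimum in
  \<open>cover_value\<close> ranges over a nonempty set.\<close>

locale edge_convex_body =
  fixes E :: "'v::finite set set" and C :: "(real^('v set)) set"
  assumes compact: "compact C" and convex: "convex C"
    and nonneg: "\<And>c e. c \<in> C \<Longrightarrow> e \<in> E \<Longrightarrow> 0 \<le> c $ e"
    and pos: "\<exists>c\<in>C. \<forall>e\<in>E. 0 < c $ e"
begin

lemma support_value_attained:
  obtains c where "c \<in> C" "support_value E C w = edge_inner E w (($) c)"
    "\<And>d. d \<in> C \<Longrightarrow> edge_inner E w (($) d) \<le> support_value E C w"
proof -
  have "continuous_on C (\<lambda>c. edge_inner E w (($) c))"
    unfolding edge_inner_def by (intro continuous_intros)
  then obtain c where c: "c \<in> C" "\<And>d. d \<in> C \<Longrightarrow> edge_inner E w (($) d) \<le> edge_inner E w (($) c)"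
    using continuous_attains_sup[OF compact, of "\<lambda>c. edge_inner E w (($) c)"] pos by blast
  have "support_value E C w = edge_inner E w (($) c)"
    unfolding support_value_def by (rule Greatest_equality) (use c in auto)
  with c that show thesis by simp
qed

lemma
  shows cover_value_attained: "\<exists>c\<in>C. \<forall>e\<in>E. z e \<le> cover_value E C z * c $ e"
    and cover_value_nonneg: "0 \<le> cover_value E C z"
    and cover_value_le: "\<And>\<mu> c. 0 \<le> \<mu> \<Longrightarrow> c \<in> C \<Longrightarrow> (\<And>e. e \<in> E \<Longrightarrow> z e \<le> \<mu> * c $ e) \<Longrightarrow> cover_value E C z \<le> \<mu>"
proof -
  obtain c0 where c0: "c0 \<in> C" "\<And>e. e \<in> E \<Longrightarrow> 0 < c0 $ e"
    using pos by blast
  \<comment> \<open>\<open>M\<close> is the least nonnegative factor with which \<open>c0\<close>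
    covers \<open>z\<close>; the inserted \<open>0\<close> also keeps the set nonempty when
    \<open>E\<close> is empty.\<close>
  define M where "M = Max (insert 0 ((\<lambda>e. z e / c0 $ e) ` E))"
  have M0: "0 \<le> M" unfolding M_def by simp
  have M: "z e \<le> M * c0 $ e" if "e \<in> E" for e
  proof -
    have "z e / c0 $ e \<le> M" unfolding M_def using that by (intro Max_ge) auto
    then show ?thesis using c0(2)[OF that] by (simp add: field_simps)
  qed
  \<comment> \<open>Factors above \<open>M\<close> cannot be minimal, so the search is confined to a
    compact set of pairs (factor, member of \<open>C\<close>), where the first component attains its
    minimum.\<close>
  define K where "K = ({0..M} \<times> C) \<inter> (\<Inter>e\<in>E. {p. z e \<le> fst p * snd p $ e})"
  have "closed {p :: real \<times> (real^('v set)). z e \<le> fst p * snd p $ e}" for e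
    by (intro closed_Collect_le continuous_intros)
  then have "compact K"
    unfolding K_def by (intro compact_Int_closed compact_Times compact compact_Icc closed_INT) auto
  moreover have "(M, c0) \<in> K" using M M0 c0 by (simp add: K_def)
  moreover have "continuous_on K fst" by (intro continuous_intros)
  ultimately obtain p where p: "p \<in> K" "\<And>q. q \<in> K \<Longrightarrow> fst p \<le> fst q"
    using continuous_attains_inf[of K fst] by blast
  have least: "fst p \<le> \<mu>" if "0 \<le> \<mu>" "c \<in> C" "\<And>e. e \<in> E \<Longrightarrow> z e \<le> \<mu> * c $ e" for \<mu> c
  proof (cases "\<mu> \<le> M")
    case True
    then show ?thesis using p(2)[of "(\<mu>, c)"] that by (auto simp: K_def)
  next
    case False
    then show ?thesis using p(1) by (auto simp: K_def)
  qed
  have eq: "cover_value E C z = fst p"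
    unfolding cover_value_def by (rule Least_equality) (use p(1) least in \<open>auto simp: K_def\<close>)
  show "\<exists>c\<in>C. \<forall>e\<in>E. z e \<le> cover_value E C z * c $ e"
    unfolding eq using p(1) by (intro bexI[of _ "snd p"]) (auto simp: K_def)
  show "0 \<le> cover_value E C z"
    unfolding eq using p(1) by (auto simp: K_def)
  show "cover_value E C z \<le> \<mu>" if "0 \<le> \<mu>" "c \<in> C" "\<And>e. e \<in> E \<Longrightarrow> z e \<le> \<mu> * c $ e" for \<mu> c
    unfolding eq using that by (rule least)
qed

lemma edge_inner_le_support_value: "c \<in> C \<Longrightarrow> edge_inner E w (($) c) \<le> support_value E C w"
  using support_value_attained[of w] by blast

lemma support_value_nonneg:
  assumes "\<And>e. e \<in> E \<Longrightarrow> 0 \<le> w e"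
  shows "0 \<le> support_value E C w"
proof -
  obtain c where c: "c \<in> C" "support_value E C w = edge_inner E w (($) c)"
    using support_value_attained[of w] by blast
  show ?thesis
    unfolding c(2) edge_inner_def by (intro sum_nonneg mult_nonneg_nonneg assms nonneg c(1))
qed

text \<open>Pairing an optimal cover of \<open>z\<close> with \<open>w\<close> gives a multiple of
  the value of \<open>w\<close> at a member of \<open>C\<close>, and that value is at most the
  support value.\<close>

lemma edge_inner_le_support_cover:
  assumes w: "\<And>e. e \<in> E \<Longrightarrow> 0 \<le> w e"
  shows "edge_inner E w z \<le> support_value E C w * cover_value E C z"
proof -
  obtain c where c: "c \<in> C" "\<And>e. e \<in> E \<Longrightarrow> z e \<le> cover_value E C z * c $ e"
    using cover_value_attained[of z] by blast
  have "edge_inner E w z \<le> cover_value E C z * edge_inner E w (($) c)"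
    using edge_inner_mono[of E w z "\<lambda>e. cover_value E C z * c $ e"] w c(2)
    by (simp add: edge_inner_scale)
  also have "\<dots> \<le> cover_value E C z * support_value E C w"
    by (intro mult_left_mono edge_inner_le_support_value cover_value_nonneg c(1))
  finally show ?thesis by (simp add: mult.commute)
qed

lemma is_max_support_value:
  assumes w: "w \<in> E \<rightarrow>\<^sub>E {0..}"
  shows "is_max {edge_inner E w z | z. z \<in> E \<rightarrow>\<^sub>E {0..} \<and> cover_value E C z \<le> 1} (support_value E C w)"
  unfolding is_max_def
proof (intro conjI ballI)
  obtain c where c: "c \<in> C" "support_value E C w = edge_inner E w (($) c)"
    using support_value_attained[of w] by blast
  \<comment> \<open>The maximiser covers itself with factor 1. It is restricted because members of
    \<open>E \<rightarrow>\<^sub>E {0..}\<close> are undefined outside \<open>E\<close>.\<close>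
  have "cover_value E C (restrict (($) c) E) \<le> 1"
    by (rule cover_value_le[of _ c]) (use c(1) in auto)
  moreover have "restrict (($) c) E \<in> E \<rightarrow>\<^sub>E {0..}"
    using c nonneg by auto
  ultimately show "support_value E C w \<in> {edge_inner E w z | z. z \<in> E \<rightarrow>\<^sub>E {0..} \<and> cover_value E C z \<le> 1}"
    using c(2) by (intro CollectI exI[of _ "restrict (($) c) E"]) simp
next
  fix x assume "x \<in> {edge_inner E w z | z. z \<in> E \<rightarrow>\<^sub>E {0..} \<and> cover_value E C z \<le> 1}"
  then obtain z where z: "x = edge_inner E w z" "cover_value E C z \<le> 1" by blast
  have w': "\<And>e. e \<in> E \<Longrightarrow> 0 \<le> w e" using w by auto
  have "x \<le> support_value E C w * cover_value E C z"
    unfolding z using w' by (rule edge_inner_le_support_cover)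
  also have "\<dots> \<le> support_value E C w"
    using z(2) support_value_nonneg[OF w'] by (simp add: mult_left_le)
  finally show "x \<le> support_value E C w" .
qed

text \<open>If \<open>c\<close> exceeded the scaled \<open>z\<close> on every edge, the finiteness
  of \<open>E\<close> would leave room for \<open>c\<close> to cover \<open>z\<close> with a factor
  smaller than the minimal one.\<close>

lemma scaled_not_strictly_below:
  assumes z: "\<And>e. e \<in> E \<Longrightarrow> 0 \<le> z e" and \<mu>: "0 < cover_value E C z" and "c \<in> C"
  shows "\<exists>e\<in>E. c $ e \<le> z e / cover_value E C z"
proof (rule ccontr)
  let ?\<mu> = "cover_value E C z"
  assume "\<not> ?thesis"
  then have less: "z e < ?\<mu> * c $ e" if "e \<in> E" for e
    using \<mu> that by (auto simp: field_simps not_le)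
  have cpos: "0 < c $ e" if "e \<in> E" for e
    using less[OF that] z[OF that] \<mu> by (metis le_less_trans zero_less_mult_pos)
  define \<nu> where "\<nu> = Max (insert 0 ((\<lambda>e. z e / c $ e) ` E))"
  have "0 \<le> \<nu>" unfolding \<nu>_def by simp
  moreover have "z e \<le> \<nu> * c $ e" if "e \<in> E" for e
  proof -
    have "z e / c $ e \<le> \<nu>" unfolding \<nu>_def using that by (intro Max_ge) auto
    then show ?thesis using cpos[OF that] by (simp add: field_simps)
  qed
  ultimately have "?\<mu> \<le> \<nu>"
    using \<open>c \<in> C\<close> by (intro cover_value_le)
  moreover have "\<nu> < ?\<mu>"
    unfolding \<nu>_def using \<mu> less cpos by (subst Max_less_iff) (auto simp: field_simps)
  ultimately show False by simp
qed

text \<open>Up to scaling, \<open>a\<close> is an optimal solution of the dual problem. It is the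
  normal of a hyperplane separating the scaled vector \<open>p\<close> from the set \<open>P\<close>
  of points strictly below \<open>C\<close>.\<close>

lemma cover_value_normal:
  assumes z: "\<And>e. e \<in> E \<Longrightarrow> 0 \<le> z e" and \<mu>: "0 < cover_value E C z"
  obtains a where "\<And>e. e \<in> E \<Longrightarrow> 0 \<le> a e" "0 < edge_inner E a z"
    "\<And>c. c \<in> C \<Longrightarrow> cover_value E C z * edge_inner E a (($) c) \<le> edge_inner E a z"
proof -
  let ?\<mu> = "cover_value E C z"
  define P where "P = {x. \<exists>c\<in>C. \<forall>e\<in>E. x $ e < c $ e}"
  define p :: "real^('v set)" where "p = (\<chi> e. z e / ?\<mu>)"
  obtain c0 where c0: "c0 \<in> C" "\<And>e. e \<in> E \<Longrightarrow> 0 < c0 $ e"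
    using pos by blast
  have "convex P"
    unfolding convex_def
  proof clarify
    fix x y and u v :: real
    assume "x \<in> P" "y \<in> P" and uv: "0 \<le> u" "0 \<le> v" "u + v = 1"
    then obtain c d where cd: "c \<in> C" "d \<in> C" "\<forall>e\<in>E. x $ e < c $ e" "\<forall>e\<in>E. y $ e < d $ e"
      by (auto simp: P_def)
    have "u * x $ e + v * y $ e < u * c $ e + v * d $ e" if "e \<in> E" for e
    \<comment> \<open>With \<open>u = 0\<close> the strict inequality comes from the
      \<open>v\<close> term, otherwise from the \<open>u\<close> term.\<close>
    proof (cases "u = 0")
      case True
      then show ?thesis using uv cd that by simp
    next
      case False
      then show ?thesis using uv cd that
        by (intro add_less_le_mono mult_strict_left_mono mult_left_mono) (auto simp: less_imp_le)
    qed
    moreover have "u *\<^sub>R c + v *\<^sub>R d \<in> C" using convex cd uv by (simp add: convex_def)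
    ultimately show "u *\<^sub>R x + v *\<^sub>R y \<in> P"
      by (auto simp: P_def intro!: bexI[of _ "u *\<^sub>R c + v *\<^sub>R d"])
  qed
  moreover have "0 \<in> P" using c0 by (auto simp: P_def)
  moreover have "p \<notin> P"
    using scaled_not_strictly_below[OF z \<mu>] by (auto simp: P_def p_def not_less[symmetric])
  ultimately obtain a b where a: "a \<noteq> 0" "\<And>x. x \<in> P \<Longrightarrow> a \<bullet> x \<le> b" "b \<le> a \<bullet> p"
    using separating_hyperplane_sets[of P "{p}"] by auto
  \<comment> \<open>\<open>P\<close> admits lowering of coordinates in \<open>E\<close> and
    arbitrary changes outside \<open>E\<close>, where the premise is vacuous. Applied to
    \<open>0\<close>, this forces the signs of \<open>a\<close>.\<close>
  have down: "x + t *\<^sub>R axis e s \<in> P" if "x \<in> P" "e \<in> E \<Longrightarrow> t * s \<le> 0" for x t e s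
    using that unfolding P_def by (force simp: axis_def)
  have bound: "t * a $ e \<le> b" if "e \<in> E \<Longrightarrow> t \<le> 0" for t e
    using a(2)[OF down[OF \<open>0 \<in> P\<close>, of e t 1]] that by (simp add: inner_axis)
  \<comment> \<open>For nonzero \<open>r\<close> the chosen \<open>t\<close> makes
    \<open>t * r\<close> equal to \<open>\<bar>b\<bar> + 1\<close>, which exceeds
    \<open>b\<close>.\<close>
  have zero_if: "r = 0" if "\<And>t. t * r \<le> b" for r
    using that[of "(\<bar>b\<bar> + 1) / r"] by (cases "r = 0") auto
  have a0: "0 \<le> a $ e" if "e \<in> E" for e
  proof (rule ccontr)
    assume "\<not> 0 \<le> a $ e"
    then show False using bound[of e "(\<bar>b\<bar> + 1) / a $ e"] by (auto simp: divide_le_0_iff)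
  qed
  have aout: "a $ e = 0" if "e \<notin> E" for e
    using zero_if bound that by blast
  have inner: "a \<bullet> x = edge_inner E (($) a) (($) x)" for x
    unfolding inner_vec_def edge_inner_def using aout
    by (intro sum.mono_neutral_cong_right) auto
  have ap: "?\<mu> * (a \<bullet> p) = edge_inner E (($) a) z"
    using \<mu> by (simp add: inner edge_inner_scale[symmetric] p_def)
  \<comment> \<open>A member \<open>c\<close> need not lie in \<open>P\<close>, but lowering all its
    coordinates by \<open>\<epsilon>\<close> puts it there; the inequality survives the limit as
    \<open>\<epsilon>\<close> decreases to 0.\<close>
  have sup: "a \<bullet> c \<le> a \<bullet> p" if "c \<in> C" for c
  proof -
    have shift: "a \<bullet> c - \<epsilon> * (a \<bullet> 1) \<le> a \<bullet> p" if "0 < \<epsilon>" for \<epsilon>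
    proof -
      have "c - \<epsilon> *\<^sub>R 1 \<in> P" using that \<open>c \<in> C\<close> by (auto simp: P_def intro!: bexI[of _ c])
      then show ?thesis using a(2,3) by (force simp: inner_diff_right)
    qed
    have "((\<lambda>\<epsilon>. a \<bullet> c - \<epsilon> * (a \<bullet> 1)) \<longlongrightarrow> a \<bullet> c - 0 * (a \<bullet> 1)) (at_right 0)"
      by (intro tendsto_intros)
    then have "a \<bullet> c - 0 * (a \<bullet> 1) \<le> a \<bullet> p"
      by (rule tendsto_upperbound) (auto simp: eventually_at_right_less shift intro: eventually_mono[OF eventually_at_right_less])
    then show ?thesis by simp
  qed
  \<comment> \<open>A nonzero \<open>a\<close> that is nonnegative on \<open>E\<close> and zero
    elsewhere pairs positively with the positive member \<open>c0\<close>. This gives the strict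
    positivity needed to divide by \<open>edge_inner E a z\<close> later.\<close>
  obtain e where e: "e \<in> E" "0 < a $ e"
    using \<open>a \<noteq> 0\<close> a0 aout by (metis order_le_less vec_eq_iff zero_index)
  have "0 < a \<bullet> c0"
    unfolding inner edge_inner_def using e a0 c0 by (intro sum_pos2[of _ e]) (auto simp: less_imp_le)
  then have "0 < a \<bullet> p" using sup[OF c0(1)] by simp
  show thesis
  proof (rule that[of "($) a"])
    show "0 < edge_inner E (($) a) z"
      using ap \<mu> \<open>0 < a \<bullet> p\<close> by (metis mult_pos_pos)
    show "?\<mu> * edge_inner E (($) a) (($) c) \<le> edge_inner E (($) a) z" if "c \<in> C" for c
      unfolding ap[symmetric] inner[symmetric] using sup[OF that] \<mu> by simp
  qed (rule a0)
qed

lemma is_max_cover_value: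
  assumes z: "z \<in> E \<rightarrow>\<^sub>E {0..}"
  shows "is_max {edge_inner E z w | w. w \<in> E \<rightarrow>\<^sub>E {0..} \<and> support_value E C w \<le> 1} (cover_value E C z)"
    (is "is_max ?A ?\<mu>")
  unfolding is_max_def
proof (intro conjI ballI)
  have z': "\<And>e. e \<in> E \<Longrightarrow> 0 \<le> z e" using z by auto
  have "\<exists>w. (\<forall>e\<in>E. 0 \<le> w e) \<and> (\<forall>c\<in>C. edge_inner E w (($) c) \<le> 1) \<and> edge_inner E z w = ?\<mu>"
  proof (cases "?\<mu> = 0")
    case True
    then show ?thesis by (intro exI[of _ "\<lambda>_. 0"]) (simp add: edge_inner_def)
  next
    case False
    then have \<mu>: "0 < ?\<mu>" using cover_value_nonneg[of z] by simp
    obtain a where a: "\<And>e. e \<in> E \<Longrightarrow> 0 \<le> a e" "0 < edge_inner E a z"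
      "\<And>c. c \<in> C \<Longrightarrow> ?\<mu> * edge_inner E a (($) c) \<le> edge_inner E a z"
      using cover_value_normal[OF z' \<mu>] by blast
    \<comment> \<open>This scaling makes the value at \<open>z\<close> exactly \<open>?\<mu>\<close>
      and turns the separation inequality into the bound 1 on \<open>C\<close>.\<close>
    let ?r = "?\<mu> / edge_inner E a z"
    have scale: "edge_inner E (\<lambda>e. ?r * a e) x = ?r * edge_inner E a x" for x
      by (metis edge_inner_commute edge_inner_scale)
    show ?thesis
    proof (intro exI[of _ "\<lambda>e. ?r * a e"] conjI ballI)
      show "0 \<le> ?r * a e" if "e \<in> E" for e using a(1)[OF that] a(2) \<mu> by simp
      show "edge_inner E (\<lambda>e. ?r * a e) (($) c) \<le> 1" if "c \<in> C" for c
        unfolding scale using a(3)[OF that] a(2) by simp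
      show "edge_inner E z (\<lambda>e. ?r * a e) = ?\<mu>"
        unfolding edge_inner_commute[of E z] scale using a(2) by simp
    qed
  qed
  then obtain w where w: "\<forall>e\<in>E. 0 \<le> w e" "\<forall>c\<in>C. edge_inner E w (($) c) \<le> 1" "edge_inner E z w = ?\<mu>"
    by blast
  have "support_value E C (restrict w E) \<le> 1"
    using w(2) support_value_attained[of "restrict w E"] by (metis edge_inner_restrict(1))
  moreover have "restrict w E \<in> E \<rightarrow>\<^sub>E {0..}" using w(1) by auto
  ultimately show "?\<mu> \<in> ?A"
    using w(3) by (intro CollectI exI[of _ "restrict w E"]) simp
next
  fix x assume "x \<in> ?A"
  then obtain w where w: "x = edge_inner E z w" "w \<in> E \<rightarrow>\<^sub>E {0..}" "support_value E C w \<le> 1" by blast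
  have "x \<le> support_value E C w * ?\<mu>"
    unfolding w(1) edge_inner_commute[of E z] using w(2)
    by (intro edge_inner_le_support_cover) auto
  also have "\<dots> \<le> ?\<mu>"
    using mult_right_mono[OF w(3) cover_value_nonneg[of z]] by simp
  finally show "x \<le> ?\<mu>" .
qed

end

section \<open>The cut polytope, maximum cut and fractional cut covering\<close>

definition cut_vector :: "'v::finite set set \<Rightarrow> 'v set \<Rightarrow> real^('v set)" where
  "cut_vector E S = (\<chi> e. indicator (cut E S) e)"

definition cut_polytope :: "'v::finite set set \<Rightarrow> (real^('v set)) set" where
  "cut_polytope E = convex hull range (cut_vector E)"

text \<open>Distinct \<open>S\<close> may give the same cut vector. Weights indexed by
  \<open>S\<close>, instead of by points of the hull, match the variables of
  \<open>fcc\<close>.\<close>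

lemma cut_polytope_combinations:
  "cut_polytope E = {\<Sum>S\<in>UNIV. y S *\<^sub>R cut_vector E S | y. (\<forall>S. 0 \<le> y S) \<and> (\<Sum>S\<in>UNIV. y S) = 1}"
    (is "_ = ?K")
proof
  have "cut_vector E S \<in> ?K" for S
  proof -
    have "cut_vector E S = (\<Sum>T\<in>UNIV. (if T = S then 1 else 0) *\<^sub>R cut_vector E T)"
      by (simp add: if_distrib[of "\<lambda>a. a *\<^sub>R _"] cong: if_cong)
    then show ?thesis
      by (intro CollectI exI[of _ "\<lambda>T. if T = S then 1 else 0"]) simp
  qed
  moreover have "convex ?K"
    unfolding convex_def
  proof clarify
    fix u v :: real and x y :: "'a set \<Rightarrow> real"
    assume uv: "0 \<le> u" "0 \<le> v" "u + v = 1"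
      and x: "\<forall>S. 0 \<le> x S" "(\<Sum>S\<in>UNIV. x S) = 1" and y: "\<forall>S. 0 \<le> y S" "(\<Sum>S\<in>UNIV. y S) = 1"
    have "(\<Sum>S\<in>UNIV. u * x S + v * y S) = 1"
      using uv x y by (simp add: sum.distrib sum_distrib_left[symmetric])
    with uv x y show "\<exists>w. u *\<^sub>R (\<Sum>S\<in>UNIV. x S *\<^sub>R cut_vector E S) + v *\<^sub>R (\<Sum>S\<in>UNIV. y S *\<^sub>R cut_vector E S) =
        (\<Sum>S\<in>UNIV. w S *\<^sub>R cut_vector E S) \<and> (\<forall>S. 0 \<le> w S) \<and> (\<Sum>S\<in>UNIV. w S) = 1"
      by (intro exI[of _ "\<lambda>S. u * x S + v * y S"])
        (simp add: scaleR_sum_right sum.distrib scaleR_add_left)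
  qed
  ultimately show "cut_polytope E \<subseteq> ?K"
    unfolding cut_polytope_def by (intro hull_minimal) blast+
  show "?K \<subseteq> cut_polytope E"
    unfolding cut_polytope_def by clarify (intro convex_sum convex_convex_hull; simp add: hull_inc)
qed

text \<open>Dividing a fractional cover by its total weight \<open>t\<close> yields a convex
  combination of cuts; multiplying by \<open>t\<close> reverses this.\<close>

lemma cut_polytope_cover_iff:
  fixes E :: "'v::finite set set"
  shows "(\<exists>y :: 'v set \<Rightarrow> real. (\<forall>S. 0 \<le> y S) \<and>
      (\<forall>e\<in>E. z e \<le> (\<Sum>S\<in>UNIV. y S * indicator (cut E S) e)) \<and> t = (\<Sum>S\<in>UNIV. y S)) \<longleftrightarrow>
    0 \<le> t \<and> (\<exists>c\<in>cut_polytope E. \<forall>e\<in>E. z e \<le> t * c $ e)" (is "?L \<longleftrightarrow> ?R")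
proof
  assume ?L
  then obtain y :: "'v set \<Rightarrow> real" where y: "\<forall>S. 0 \<le> y S" "t = (\<Sum>S\<in>UNIV. y S)"
    "\<forall>e\<in>E. z e \<le> (\<Sum>S\<in>UNIV. y S * indicator (cut E S) e)" by blast
  have t: "0 \<le> t" using y(1,2) by (simp add: sum_nonneg)
  show ?R
  \<comment> \<open>Normalisation is impossible at \<open>t = 0\<close>, but then \<open>y\<close>
    vanishes and \<open>z\<close> is nonpositive on \<open>E\<close>, so any member of the polytope
    serves.\<close>
  proof (cases "t = 0")
    case True
    then have "y S = 0" for S using y(1,2) by (simp add: sum_nonneg_eq_0_iff)
    then have "\<forall>e\<in>E. z e \<le> 0" using y(3) by simp
    moreover have "cut_vector E {} \<in> cut_polytope E" by (simp add: cut_polytope_def hull_inc)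
    ultimately show ?thesis using True by auto
  next
    case False
    define c where "c = (\<Sum>S\<in>UNIV. (y S / t) *\<^sub>R cut_vector E S)"
    have "(\<Sum>S\<in>UNIV. y S / t) = 1"
      using False y(2) by (simp add: sum_divide_distrib[symmetric])
    then have "c \<in> cut_polytope E"
      unfolding cut_polytope_combinations c_def
      by (intro CollectI exI[of _ "\<lambda>S. y S / t"]) (use y(1) t in simp)
    moreover have "t * c $ e = (\<Sum>S\<in>UNIV. y S * indicator (cut E S) e)" for e
      using False by (simp add: c_def cut_vector_def sum_distrib_left)
    ultimately show ?thesis using t y(3) by (intro conjI bexI[of _ c]) auto
  qed
next
  assume ?R
  then obtain y where y: "0 \<le> t" "\<forall>S. 0 \<le> y S" "(\<Sum>S\<in>UNIV. y S) = (1::real)"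
    "\<forall>e\<in>E. z e \<le> t * (\<Sum>S\<in>UNIV. y S *\<^sub>R cut_vector E S) $ e"
    unfolding cut_polytope_combinations by blast
  then show ?L
    by (intro exI[of _ "\<lambda>S. t * y S"])
      (simp add: cut_vector_def sum_distrib_left[symmetric] mult.assoc)
qed

lemma fcc_eq_cover_value: "fcc E z = cover_value E (cut_polytope E) z"
  unfolding fcc_def cover_value_def by (simp only: cut_polytope_cover_iff Pow_UNIV)

text \<open>A linear bound valid at all cut vectors defines a convex half-space, hence holds on
  their hull, and the maximum is attained at a cut vector.\<close>

lemma mc_eq_support_value: "mc E w = support_value E (cut_polytope E) w"
proof -
  let ?A = "range (\<lambda>S. edge_inner E w (indicator (cut E S)))"
  have A: "mc E w = Max ?A"
    unfolding mc_def by (intro arg_cong[of _ _ Max]) auto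
  have cut: "edge_inner E w (($) (cut_vector E S)) = edge_inner E w (indicator (cut E S))" for S
    by (simp add: cut_vector_def edge_inner_def)
  have "convex {c. edge_inner E w (($) c) \<le> mc E w}"
  proof -
    have "edge_inner E w (($) c) = (\<chi> e. if e \<in> E then w e else 0) \<bullet> c" for c
      unfolding edge_inner_def inner_vec_def by (intro sum.mono_neutral_cong_left) auto
    then show ?thesis by (simp add: convex_halfspace_le)
  qed
  then have "cut_polytope E \<subseteq> {c. edge_inner E w (($) c) \<le> mc E w}"
    unfolding cut_polytope_def by (intro hull_minimal) (auto simp: A cut)
  moreover have "mc E w \<in> ?A" unfolding A by (intro Max_in) auto
  then obtain S where "mc E w = edge_inner E w (($) (cut_vector E S))"
    by (auto simp: cut)
  moreover have "cut_vector E S \<in> cut_polytope E" by (simp add: cut_polytope_def hull_inc)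
  ultimately show ?thesis
    unfolding support_value_def by (intro Greatest_equality[symmetric]) auto
qed

lemma edge_convex_body_cut_polytope:
  assumes "simple_graph E"
  shows "edge_convex_body E (cut_polytope E)"
proof
  show "compact (cut_polytope E)"
    unfolding cut_polytope_def by (intro finite_imp_compact_convex_hull) simp
  show "convex (cut_polytope E)"
    by (simp add: cut_polytope_def convex_convex_hull)
  show "0 \<le> c $ e" if "c \<in> cut_polytope E" for c e
    using that by (auto simp: cut_polytope_combinations cut_vector_def intro!: sum_nonneg)
  define n where "n = real (card (UNIV :: 'a set set))"
  have n: "0 < n" unfolding n_def by (simp add: card_gt_0_iff)
  \<comment> \<open>The uniform average of all cut vectors is positive on \<open>E\<close>, since
    every edge is cut by the singleton of one of its ends.\<close>
  define c where "c = (\<Sum>S\<in>UNIV. (1 / n) *\<^sub>R cut_vector E S)"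
  have "c \<in> cut_polytope E"
    unfolding cut_polytope_combinations c_def
    by (intro CollectI exI[of _ "\<lambda>S. 1 / n"]) (use n in \<open>simp add: n_def\<close>)
  moreover have "0 < c $ e" if "e \<in> E" for e
  proof -
    have "card e = 2" using assms that by (simp add: simple_graph_def)
    then obtain i j where "e = {i, j}" "i \<noteq> j" by (auto simp: card_2_iff)
    then have "e \<in> cut E {i}" using that by (simp add: cut_def)
    then show ?thesis
      using n by (auto simp: c_def cut_vector_def intro!: sum_pos2[of _ "{i}"])
  qed
  ultimately show "\<exists>c\<in>cut_polytope E. \<forall>e\<in>E. 0 < c $ e" by blast
qed

section \<open>The elliptope and the two semidefinite programs\<close>

definition elliptope :: "(real^'v^'v::finite) set" where
  "elliptope = {Y. psd Y \<and> (\<forall>i. Y $ i $ i = 1)}"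

text \<open>The value 0 outside \<open>E\<close> keeps the map linear: \<open>on_ends\<close> is
  unspecified on sets that are not of the form \<open>{i, j}\<close>.\<close>

definition edge_vector :: "'v::finite set set \<Rightarrow> real^'v^'v \<Rightarrow> real^('v set)" where
  "edge_vector E Y = (\<chi> e. if e \<in> E then 1/4 * laplacian_adj Y e else 0)"

lemma psd_scaleR: "psd Y \<Longrightarrow> 0 \<le> r \<Longrightarrow> psd (r *\<^sub>R Y)"
  by (simp add: psd_def transpose_scalar scaleR_matrix_vector_assoc[symmetric])

lemma psd_add: "psd X \<Longrightarrow> psd Y \<Longrightarrow> psd (X + Y)"
  by (auto simp: psd_def matrix_vector_mult_add_rdistrib inner_add_right transpose_def vec_eq_iff)

lemma psd_mat_1: "psd (mat 1)"
  by (simp add: psd_def transpose_mat)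

lemma quadratic_form_axis:
  fixes Y :: "real^'v^'v::finite"
  shows "(axis i 1 + s *\<^sub>R axis j 1) \<bullet> (Y *v (axis i 1 + s *\<^sub>R axis j 1)) =
    Y $ i $ i + s * Y $ i $ j + s * Y $ j $ i + s * s * Y $ j $ j"
  by (simp add: matrix_vector_right_distrib matrix_vector_mult_scaleR matrix_vector_mul_component inner_add_left inner_add_right inner_axis
      inner_axis' algebra_simps row_def)

text \<open>The quadratic form is tested at the sum and the difference of two unit vectors. The
  first bound makes \<open>edge_vector\<close> nonnegative; both together bound each off-diagonal
  entry by the mean of two diagonal ones.\<close>

lemma psd_minor_bounds:
  assumes "psd Y"
  shows "Y $ i $ j = Y $ j $ i" "0 \<le> Y $ i $ i + Y $ j $ j - 2 * Y $ i $ j"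
    "0 \<le> Y $ i $ i + Y $ j $ j + 2 * Y $ i $ j"
proof -
  show sym: "Y $ i $ j = Y $ j $ i"
    using assms unfolding psd_def by (metis transpose_def vec_lambda_beta)
  have form: "0 \<le> Y $ i $ i + s * Y $ i $ j + s * Y $ j $ i + s * s * Y $ j $ j" for s
    using assms unfolding psd_def by (metis quadratic_form_axis)
  show "0 \<le> Y $ i $ i + Y $ j $ j - 2 * Y $ i $ j"
    using form[of "-1"] sym by simp
  show "0 \<le> Y $ i $ i + Y $ j $ j + 2 * Y $ i $ j"
    using form[of 1] sym by simp
qed

lemma compact_elliptope: "compact (elliptope :: (real^'v^'v::finite) set)"
  unfolding compact_eq_bounded_closed
proof
  have entry: "\<bar>Y $ i $ j\<bar> \<le> 1" if "Y \<in> elliptope" for Y :: "real^'v^'v" and i j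
    using that psd_minor_bounds[of Y i j] by (auto simp: elliptope_def)
  have "norm Y \<le> (\<Sum>i\<in>(UNIV::'v set). \<Sum>j\<in>(UNIV::'v set). 1)"
    if "Y \<in> elliptope" for Y :: "real^'v^'v"
  proof -
    have "norm Y \<le> (\<Sum>i\<in>UNIV. norm (Y $ i))"
      by (simp add: norm_vec_def L2_set_le_sum)
    also have "\<dots> \<le> (\<Sum>i\<in>UNIV. \<Sum>j\<in>UNIV. \<bar>Y $ i $ j\<bar>)"
      by (intro sum_mono norm_le_l1_cart)
    also have "\<dots> \<le> (\<Sum>i\<in>(UNIV::'v set). \<Sum>j\<in>(UNIV::'v set). 1)"
      by (intro sum_mono entry that)
    finally show ?thesis .
  qed
  then show "bounded (elliptope :: (real^'v^'v) set)" unfolding bounded_iff by blast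
  \<comment> \<open>In coordinates, each condition is a closed equality or inequality between
    continuous functions of \<open>Y\<close>.\<close>
  have "elliptope = {Y :: real^'v^'v. (\<forall>i j. Y $ j $ i = Y $ i $ j) \<and>
      (\<forall>x. 0 \<le> (\<Sum>i\<in>UNIV. x $ i * (\<Sum>j\<in>UNIV. Y $ i $ j * x $ j))) \<and> (\<forall>i. Y $ i $ i = 1)}"
    by (simp add: elliptope_def psd_def transpose_def vec_eq_iff inner_vec_def matrix_vector_mult_def)
  also have "closed \<dots>"
    by (intro closed_Collect_conj closed_Collect_all closed_Collect_le closed_Collect_eq continuous_intros)
  finally show "closed (elliptope :: (real^'v^'v) set)" .
qed

lemma convex_elliptope: "convex elliptope"
  by (auto simp: convex_def elliptope_def intro!: psd_add psd_scaleR)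

lemma simple_graph_edgeE:
  assumes "simple_graph E" "e \<in> E"
  obtains i j where "e = {i, j}" "i \<noteq> j"
  using assms by (auto simp: simple_graph_def card_2_iff)

lemma linear_edge_vector:
  assumes "simple_graph E"
  shows "linear (edge_vector E)"
proof -
  have "laplacian_adj (X + Y) e = laplacian_adj X e + laplacian_adj Y e"
    "laplacian_adj (r *\<^sub>R X) e = r * laplacian_adj X e" if "e \<in> E" for X Y e r
    using assms that by (auto elim!: simple_graph_edgeE simp: laplacian_adj_doubleton algebra_simps)
  then show ?thesis
    by (intro linearI) (auto simp: edge_vector_def vec_eq_iff algebra_simps)
qed

lemma edge_convex_body_elliptope:
  assumes "simple_graph E"
  shows "edge_convex_body E (edge_vector E ` elliptope)"
proof
  note lin = linear_edge_vector[OF assms]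
  show "compact (edge_vector E ` elliptope)"
    by (intro compact_continuous_image compact_elliptope linear_continuous_on)
      (use lin in \<open>simp add: linear_conv_bounded_linear\<close>)
  show "convex (edge_vector E ` elliptope)"
    by (rule convex_linear_image[OF lin convex_elliptope])
  show "0 \<le> c $ e" if "c \<in> edge_vector E ` elliptope" "e \<in> E" for c e
  proof -
    obtain i j where "e = {i, j}" using simple_graph_edgeE[OF assms \<open>e \<in> E\<close>] .
    moreover obtain Y where "psd Y" "c = edge_vector E Y" using \<open>c \<in> _\<close> unfolding elliptope_def by blast
    ultimately show ?thesis
      using psd_minor_bounds[of Y i j] by (simp add: edge_vector_def laplacian_adj_doubleton)
  qed
  \<comment> \<open>The identity matrix supplies the positive member: its edge vector is 1/2 on
    every edge.\<close>
  have "mat 1 \<in> elliptope" by (simp add: elliptope_def psd_mat_1) (simp add: mat_def)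
  moreover have "0 < edge_vector E (mat 1) $ e" if "e \<in> E" for e
  proof -
    obtain i j where "e = {i, j}" "i \<noteq> j" using simple_graph_edgeE[OF assms \<open>e \<in> E\<close>] .
    then show ?thesis
      using that by (simp add: edge_vector_def laplacian_adj_doubleton mat_def)
  qed
  ultimately show "\<exists>c\<in>edge_vector E ` elliptope. \<forall>e\<in>E. 0 < c $ e" by blast
qed

text \<open>A feasible matrix with constant diagonal \<open>\<mu>\<close> is \<open>\<mu>\<close>
  times a member of the elliptope, and \<open>edge_vector\<close> is homogeneous.\<close>

lemma GW_polar_eq_cover_value:
  assumes "simple_graph E"
  shows "GW_polar E z = cover_value E (edge_vector E ` elliptope) z"
proof -
  have scale: "edge_vector E (r *\<^sub>R Y) = r *\<^sub>R edge_vector E Y" for r Y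
    using linear_scale[OF linear_edge_vector[OF assms]] .
  have adj: "1/4 * laplacian_adj Y e = edge_vector E Y $ e" if "e \<in> E" for Y e
    using that by (simp add: edge_vector_def)
  have "(\<exists>Y. psd Y \<and> (\<forall>i. Y $ i $ i = \<mu>) \<and> (\<forall>e\<in>E. z e \<le> 1/4 * laplacian_adj Y e)) \<longleftrightarrow>
    (\<exists>Y\<in>elliptope. \<forall>e\<in>E. z e \<le> \<mu> * edge_vector E Y $ e)" (is "?L \<longleftrightarrow> ?R") if "0 \<le> \<mu>" for \<mu>
  proof
    assume ?L
    then obtain Y where Y: "psd Y" "\<forall>i. Y $ i $ i = \<mu>" "\<forall>e\<in>E. z e \<le> edge_vector E Y $ e"
      using adj by fastforce
    show ?R
    \<comment> \<open>A positive semidefinite matrix with zero diagonal is zero, so at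
      \<open>\<mu> = 0\<close> the demand is nonpositive and the identity matrix can stand
      in.\<close>
    proof (cases "\<mu> = 0")
      case True
      have "Y $ i $ j = 0" for i j
        using psd_minor_bounds[OF Y(1), of i j] Y(2) True by simp
      then have "Y = 0 *\<^sub>R Y" by (simp add: vec_eq_iff)
      then have "edge_vector E Y = 0" by (metis scale scaleR_zero_left)
      moreover have "mat 1 \<in> elliptope" by (simp add: elliptope_def psd_mat_1) (simp add: mat_def)
      ultimately show ?thesis using True Y(3) by auto
    next
      case False
      then have "(1 / \<mu>) *\<^sub>R Y \<in> elliptope"
        using Y(1,2) that by (simp add: elliptope_def psd_scaleR)
      then show ?thesis
        using False Y(3) by (intro bexI[of _ "(1 / \<mu>) *\<^sub>R Y"]) (simp_all add: scale)
    qed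
  next
    assume ?R
    then obtain Y where "Y \<in> elliptope" "\<forall>e\<in>E. z e \<le> \<mu> * edge_vector E Y $ e" by blast
    moreover have "1/4 * laplacian_adj (\<mu> *\<^sub>R Y) e = \<mu> * edge_vector E Y $ e" if "e \<in> E" for e
      using adj[OF that, of "\<mu> *\<^sub>R Y"] by (simp add: scale)
    ultimately show ?L
      using that by (intro exI[of _ "\<mu> *\<^sub>R Y"]) (simp add: elliptope_def psd_scaleR)
  qed
  then show ?thesis
    unfolding GW_polar_def cover_value_def by (intro arg_cong[of _ _ Least] ext) auto
qed

lemma mat_inner_sum: "mat_inner A B = (\<Sum>i\<in>UNIV. \<Sum>j\<in>UNIV. A $ i $ j * B $ i $ j)"
  unfolding mat_inner_def trace_def matrix_matrix_mult_def transpose_def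
  by (subst sum.swap) simp

lemma mat_inner_edge_matrix:
  "mat_inner (edge_matrix i j) Y = Y $ i $ i + Y $ j $ j - Y $ i $ j - Y $ j $ i"
proof -
  have axis_sum: "(\<Sum>k\<in>UNIV. axis i (1::real) $ k * f k) = f i" for i :: 'a and f
    by (simp add: axis_def if_distrib[of "\<lambda>a. a * _"] cong: if_cong)
  have "mat_inner (edge_matrix i j) Y =
      (\<Sum>k\<in>UNIV. (axis i 1 - axis j 1) $ k * (\<Sum>l\<in>UNIV. (axis i 1 - axis j 1) $ l * Y $ k $ l))"
    by (simp add: mat_inner_sum edge_matrix_def columnvector_def rowvector_def
        matrix_matrix_mult_def sum_distrib_left mult.assoc)
  also have "\<dots> = Y $ i $ i + Y $ j $ j - Y $ i $ j - Y $ j $ i"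
    by (simp add: left_diff_distrib sum_subtractf axis_sum)
  finally show ?thesis .
qed

text \<open>This is the adjointness of the Laplacian map, reduced by linearity to a single edge. It
  makes the \<open>GW\<close> objective linear in \<open>edge_vector E Y\<close>.\<close>

lemma mat_inner_laplacian:
  assumes "simple_graph E"
  shows "mat_inner ((1/4) *\<^sub>R laplacian E w) Y = edge_inner E w (($) (edge_vector E Y))"
proof -
  have lin: "linear (\<lambda>A. mat_inner A Y)"
    by (intro linearI) (simp_all add: mat_inner_sum sum.distrib sum_distrib_left algebra_simps)
  have "mat_inner ((1/4) *\<^sub>R laplacian E w) Y = (\<Sum>e\<in>E. w e * (1/4 * mat_inner (on_ends edge_matrix e) Y))"
    by (simp add: laplacian_def linear_sum[OF lin] linear_scale[OF lin] sum_distrib_left)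
  also have "\<dots> = (\<Sum>e\<in>E. w e * (1/4 * laplacian_adj Y e))"
  proof (intro sum.cong refl)
    fix e assume "e \<in> E"
    with assms obtain i j where "e = {i, j}" by (rule simple_graph_edgeE)
    then show "w e * (1/4 * mat_inner (on_ends edge_matrix e) Y) = w e * (1/4 * laplacian_adj Y e)"
      by (simp add: on_ends_edge_matrix laplacian_adj_doubleton mat_inner_edge_matrix)
  qed
  finally show ?thesis by (simp add: edge_inner_def edge_vector_def)
qed

lemma GW_eq_support_value:
  assumes "simple_graph E"
  shows "GW E w = support_value E (edge_vector E ` elliptope) w"
  unfolding GW_def support_value_def mat_inner_laplacian[OF assms]
  by (intro arg_cong[of _ _ Greatest] ext) (auto simp: elliptope_def)

theorem proposition8:
  fixes E :: "'v::finite set set"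
  assumes "simple_graph E"
  shows
    "(\<forall>w \<in> E \<rightarrow>\<^sub>E {0..}.
        is_max {edge_inner E w z | z. z \<in> E \<rightarrow>\<^sub>E {0..} \<and> fcc E z \<le> 1} (mc E w)) \<and>
     (\<forall>z \<in> E \<rightarrow>\<^sub>E {0..}.
        is_max {edge_inner E z w | w. w \<in> E \<rightarrow>\<^sub>E {0..} \<and> mc E w \<le> 1} (fcc E z)) \<and>
     (\<forall>w \<in> E \<rightarrow>\<^sub>E {0..}. \<forall>z \<in> E \<rightarrow>\<^sub>E {0..}.
        edge_inner E w z \<le> mc E w * fcc E z) \<and>
     (\<forall>w \<in> E \<rightarrow>\<^sub>E {0..}.
        is_max {edge_inner E w z | z. z \<in> E \<rightarrow>\<^sub>E {0..} \<and> GW_polar E z \<le> 1} (GW E w)) \<and>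
     (\<forall>z \<in> E \<rightarrow>\<^sub>E {0..}.
        is_max {edge_inner E z w | w. w \<in> E \<rightarrow>\<^sub>E {0..} \<and> GW E w \<le> 1} (GW_polar E z)) \<and>
     (\<forall>w \<in> E \<rightarrow>\<^sub>E {0..}. \<forall>z \<in> E \<rightarrow>\<^sub>E {0..}.
        edge_inner E w z \<le> GW E w * GW_polar E z)"
proof -
  interpret C: edge_convex_body E "cut_polytope E"
    by (rule edge_convex_body_cut_polytope[OF assms])
  interpret Y: edge_convex_body E "edge_vector E ` elliptope"
    by (rule edge_convex_body_elliptope[OF assms])
  show ?thesis
    unfolding mc_eq_support_value fcc_eq_cover_value GW_eq_support_value[OF assms]
      GW_polar_eq_cover_value[OF assms]
    by (intro conjI ballI C.is_max_support_value C.is_max_cover_value C.edge_inner_le_support_cover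
        Y.is_max_support_value Y.is_max_cover_value Y.edge_inner_le_support_cover) auto
qed

end
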